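(* Let $\mathscr P=\{\mathbf P_\delta:\delta\in\Delta\}$ be a collection of $N\times N$ stochastic matrices, and let $\mathbf P_*$ be an aperiodic $N\times N$ stochastic matrix with a single ergodic class and invariant probability distribution $\boldsymbol\sigma_*$. Let $\epsilon:=\sup_{\delta\in\Delta}\|\mathbf P_\delta-\mathbf P_*\|_1$. Let $(X(t))_{t\ge0}$ be a time-inhomogeneous Markov chain with initial distribution $\mathbf y(0)$ whose transition probability matrix at each time $t$ is some $\mathbf P_{\delta_t}\in\mathscr P$, and let $(\mathbf y(t))_{t\ge0}$ be the resulting sequence of marginal distributions. Then for any $\mathbf y(0)$: (a) for every $n\ge1$, the marginal distribution satisfies $$\|\mathbf y(n)-\boldsymbol\sigma_*\|_1\le\tau_1(\mathbf P_*^n)\,\|\mathbf y(0)-\boldsymbol\sigma_*\|_1+\epsilon\sum_{\ell=0}^{n-1}\tau_1(\mathbf P_*^\ell);$$ (b) the limiting distribution satisfies $$\limsup_{n\to\infty}\|\mathbf y(n)-\boldsymbol\sigma_*\|_1\le\epsilon\,\Upsilon(\mathbf P_* ),$$ where $\Upsilon(\mathbf P_* ):=\sum_{\ell=0}^\infty\tau_1(\mathbf P_*^\ell)\le\dfrac{\hat m}{1-\tau_1(\mathbf P_*^{\hat m})}$, and $\hat m$ is a positive integer such that $\mathbf P_*^k$ is scrambling for all $k\ge\hat m$.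
   Context: Probability distributions are row vectors, so $\mathbf y(t+1)=\mathbf y(t)\mathbf P$ where $\mathbf P$ is the transition matrix used at that step. For vectors $\|\cdot\|_1$ is the $\ell_1$ norm; for a matrix $\mathbf B$, $\|\mathbf B\|_1$ denotes the operator norm induced by the $\ell_1$ norm under the action $\mathbf x\mapsto\mathbf x\mathbf B$ on row vectors, i.e. $\max_i\sum_j|B_{ij}|$. The coefficient of ergodicity of an $N\times N$ stochastic matrix $\mathbf P$ is $$\tau_1(\mathbf P):=\max_{\mathbf z^{\mathsf T}\mathbf 1_N=0,\ \|\mathbf z\|_1=1}\|\mathbf P^{\mathsf T}\mathbf z\|_1 .$$ A stochastic matrix is scrambling if it has no pair of orthogonal rows; equivalently $\tau_1(\mathbf P)<1$. For an aperiodic stochastic matrix $\mathbf P_*$ with a single ergodic (recurrent) class, it is known that an integer $\hat m$ as in the claim exists. *)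

theory Defs
  imports "HOL-Probability.Probability"
begin

text \<open>Probability distributions are row vectors, so a matrix acts on them by \<open>x v* B\<close>.\<close>

definition norm1 :: "real ^ 'n \<Rightarrow> real" where
  "norm1 x = (\<Sum>i\<in>UNIV. \<bar>x $ i\<bar>)"

definition mat_norm1 :: "real ^ 'n ^ 'n \<Rightarrow> real" where
  "mat_norm1 B = (SUP x\<in>{x. norm1 x = 1}. norm1 (x v* B))"

text \<open>The operation \<open>^\<close> on the type \<open>real ^ 'n ^ 'n\<close> is the entrywise power.\<close>

primrec mpow :: "real ^ 'n ^ 'n \<Rightarrow> nat \<Rightarrow> real ^ 'n ^ 'n" where
  "mpow A 0 = mat 1"
| "mpow A (Suc k) = A ** mpow A k"

definition distribution :: "real ^ 'n \<Rightarrow> bool" where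
  "distribution x \<longleftrightarrow> (\<forall>i. 0 \<le> x $ i) \<and> (\<Sum>i\<in>UNIV. x $ i) = 1"

definition stochastic :: "real ^ 'n ^ 'n \<Rightarrow> bool" where
  "stochastic P \<longleftrightarrow> (\<forall>i. distribution (row i P))"

definition invariant :: "real ^ 'n ^ 'n \<Rightarrow> real ^ 'n \<Rightarrow> bool" where
  "invariant P x \<longleftrightarrow> distribution x \<and> x v* P = x"

text \<open>Inserting \<open>0\<close> matters only for a single state, where no admissible vector \<open>z\<close> exists
  and \<open>Sup {}\<close> is unspecified; the coefficient is then \<open>0\<close>. Otherwise the supremum is over a
  nonempty compact set, and so is a maximum.\<close>

definition tau1 :: "real ^ 'n ^ 'n \<Rightarrow> real" where
  "tau1 P = Sup (insert 0 {norm1 (transpose P *v z) | z. (\<Sum>i\<in>UNIV. z $ i) = 0 \<and> norm1 z = 1})"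

definition scrambling :: "real ^ 'n ^ 'n \<Rightarrow> bool" where
  "scrambling P \<longleftrightarrow> (\<forall>i j. i \<noteq> j \<longrightarrow> \<not> orthogonal (row i P) (row j P))"

definition Upsilon :: "real ^ 'n ^ 'n \<Rightarrow> real" where
  "Upsilon P = (\<Sum>l. tau1 (mpow P l))"

definition accessible :: "real ^ 'n ^ 'n \<Rightarrow> 'n \<Rightarrow> 'n \<Rightarrow> bool" where
  "accessible P i j \<longleftrightarrow> (\<exists>k. mpow P k $ i $ j > 0)"

text \<open>A recurrent class of a finite chain is a communicating class that cannot be left.\<close>

definition ergodic_class :: "real ^ 'n ^ 'n \<Rightarrow> 'n set \<Rightarrow> bool" where
  "ergodic_class P C \<longleftrightarrow> C \<noteq> {}
     \<and> (\<forall>i\<in>C. \<forall>j\<in>C. accessible P i j)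
     \<and> (\<forall>i\<in>C. \<forall>j. accessible P i j \<longrightarrow> j \<in> C)"

definition period :: "real ^ 'n ^ 'n \<Rightarrow> 'n \<Rightarrow> nat" where
  "period P i = Gcd {k. 0 < k \<and> mpow P k $ i $ i > 0}"

text \<open>Aperiodicity constrains the recurrent states only: a transient state may have
  another period, or no return time at all.\<close>

definition aperiodic :: "real ^ 'n ^ 'n \<Rightarrow> bool" where
  "aperiodic P \<longleftrightarrow> (\<forall>C. ergodic_class P C \<longrightarrow> (\<forall>i\<in>C. period P i = 1))"

text \<open>The matrix \<open>Q t\<close> governs the step from time \<open>t\<close> to time \<open>t + 1\<close>.\<close>

definition markov_chain ::
    "'a measure \<Rightarrow> (nat \<Rightarrow> 'a \<Rightarrow> 'n) \<Rightarrow> (nat \<Rightarrow> real ^ 'n ^ 'n) \<Rightarrow> bool" where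
  "markov_chain M X Q \<longleftrightarrow> prob_space M
     \<and> (\<forall>t. X t \<in> measurable M (count_space UNIV))
     \<and> (\<forall>t x j. \<P>(\<omega> in M. \<forall>s\<le>t. X s \<omega> = x s) > 0 \<longrightarrow>
          \<P>(\<omega> in M. X (Suc t) \<omega> = j \<bar> \<forall>s\<le>t. X s \<omega> = x s) = Q t $ x t $ j)"

definition marginal :: "'a measure \<Rightarrow> ('a \<Rightarrow> 'n) \<Rightarrow> real ^ 'n" where
  "marginal M Y = (\<chi> i. \<P>(\<omega> in M. Y \<omega> = i))"

lemma norm1_nonneg: "0 \<le> norm1 x"
  unfolding norm1_def by (simp add: sum_nonneg)

lemma norm1_axis: "norm1 (axis i 1) = 1"
proof -
  have "norm1 (axis i 1) = (\<Sum>j\<in>UNIV. if i = j then 1 else 0)"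
    unfolding norm1_def by (rule sum.cong) (auto simp: axis_def)
  then show ?thesis by simp
qed

lemma norm1_axis_vector_matrix: "norm1 (axis i 1 v* B) = (\<Sum>j\<in>UNIV. \<bar>B $ i $ j\<bar>)"
proof -
  have "(axis i 1 v* B) $ j = B $ i $ j" for j
  proof -
    have "(axis i 1 v* B) $ j = (\<Sum>k\<in>UNIV. if k = i then B $ k $ j else 0)"
      unfolding vector_matrix_mult_def vec_lambda_beta
      by (rule sum.cong) (auto simp: axis_def)
    then show ?thesis by simp
  qed
  then show ?thesis by (simp add: norm1_def)
qed

lemma norm1_vector_matrix_le:
  "norm1 (x v* B) \<le> norm1 x * Max (range (\<lambda>i. \<Sum>j\<in>UNIV. \<bar>B $ i $ j\<bar>))"
  (is "_ \<le> _ * ?m")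
proof -
  have "norm1 (x v* B) \<le> (\<Sum>j\<in>UNIV. \<Sum>i\<in>UNIV. \<bar>x $ i\<bar> * \<bar>B $ i $ j\<bar>)"
    unfolding norm1_def vector_matrix_mult_def vec_lambda_beta
    by (intro sum_mono order_trans[OF sum_abs]) (simp add: abs_mult)
  also have "\<dots> = (\<Sum>i\<in>UNIV. \<bar>x $ i\<bar> * (\<Sum>j\<in>UNIV. \<bar>B $ i $ j\<bar>))"
    by (subst sum.swap) (simp add: sum_distrib_left)
  also have "\<dots> \<le> (\<Sum>i\<in>UNIV. \<bar>x $ i\<bar> * ?m)"
    by (intro sum_mono mult_left_mono Max_ge) auto
  finally show ?thesis by (simp add: norm1_def sum_distrib_right)
qed

lemma mat_norm1_eq_Max: "mat_norm1 B = Max (range (\<lambda>i. \<Sum>j\<in>UNIV. \<bar>B $ i $ j\<bar>))"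
proof -
  have "Max (range (\<lambda>i. \<Sum>j\<in>UNIV. \<bar>B $ i $ j\<bar>)) \<in> range (\<lambda>i. \<Sum>j\<in>UNIV. \<bar>B $ i $ j\<bar>)"
    by (rule Max_in) auto
  then obtain i where i: "Max (range (\<lambda>i. \<Sum>j\<in>UNIV. \<bar>B $ i $ j\<bar>)) = (\<Sum>j\<in>UNIV. \<bar>B $ i $ j\<bar>)"
    by (rule imageE)
  show ?thesis
    unfolding mat_norm1_def
  proof (rule cSup_eq_maximum)
    show "Max (range (\<lambda>i. \<Sum>j\<in>UNIV. \<bar>B $ i $ j\<bar>)) \<in> (\<lambda>x. norm1 (x v* B)) ` {x. norm1 x = 1}"
      by (rule image_eqI[of _ _ "axis i 1"]) (simp_all only: i norm1_axis norm1_axis_vector_matrix mem_Collect_eq)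
  next
    fix y assume "y \<in> (\<lambda>x. norm1 (x v* B)) ` {x. norm1 x = 1}"
    then obtain x where "norm1 x = 1" "y = norm1 (x v* B)" by blast
    then show "y \<le> Max (range (\<lambda>i. \<Sum>j\<in>UNIV. \<bar>B $ i $ j\<bar>))"
      using norm1_vector_matrix_le[of x B] by (simp only: mult_1)
  qed
qed

end

theory Submission
  imports Defs
begin

text \<open>Writing \<open>S\<close> for the reference matrix and \<open>Q t\<close> for the one used at time \<open>t\<close>, invariance of
  \<open>\<sigma>\<close> gives \<open>y (t + 1) - \<sigma> = (y t - \<sigma>) S + y t (Q t - S)\<close>. Both summands have total mass \<open>0\<close>,
  and each later factor \<open>S\<close> contracts such vectors, so unrolling the recursion yields the
  finite-time bound. For the limit, \<open>\<tau>\<close> is submultiplicative and less than \<open>1\<close> on scrambling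
  matrices, so \<open>\<tau> (S ^ l) \<le> \<tau> (S ^ m) ^ (l div m)\<close>, which sums to \<open>m / (1 - \<tau> (S ^ m))\<close>.
  Powers of \<open>S\<close> become scrambling because a recurrent state has positive return probability at
  all late times and is reached from everywhere: its column in a high power of \<open>S\<close> is positive.\<close>

section \<open>The l1 norm and stochastic matrices\<close>

lemma norm1_triangle: "norm1 (x + y) \<le> norm1 x + norm1 y"
  unfolding norm1_def by (simp add: sum.distrib[symmetric] sum_mono abs_triangle_ineq)

lemma norm1_scaleR: "norm1 (c *\<^sub>R x) = \<bar>c\<bar> * norm1 x"
  unfolding norm1_def by (simp add: abs_mult sum_distrib_left)

lemma norm1_eq_0_iff: "norm1 x = 0 \<longleftrightarrow> x = 0"
  unfolding norm1_def by (simp add: sum_nonneg_eq_0_iff vec_eq_iff)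

lemma norm1_distribution: "distribution x \<Longrightarrow> norm1 x = 1"
  unfolding norm1_def distribution_def by simp

lemma norm1_vector_matrix_le_mat_norm1: "norm1 (x v* B) \<le> norm1 x * mat_norm1 B"
  using norm1_vector_matrix_le[of x B] by (simp only: mat_norm1_eq_Max)

lemma stochastic_nonneg: "stochastic P \<Longrightarrow> 0 \<le> P $ i $ j"
  by (simp add: stochastic_def distribution_def row_def)

lemma stochastic_row_sum: "stochastic P \<Longrightarrow> (\<Sum>j\<in>UNIV. P $ i $ j) = 1"
  by (simp add: stochastic_def distribution_def row_def)

lemma stochasticI:
  assumes "\<And>i j. 0 \<le> P $ i $ j" "\<And>i. (\<Sum>j\<in>UNIV. P $ i $ j) = 1"
  shows "stochastic P"
  using assms by (simp add: stochastic_def distribution_def row_def)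

lemma sum_vector_matrix_stochastic:
  assumes "stochastic P"
  shows "(\<Sum>j\<in>UNIV. (x v* P) $ j) = (\<Sum>i\<in>UNIV. x $ i)"
proof -
  have "(\<Sum>j\<in>UNIV. (x v* P) $ j) = (\<Sum>i\<in>UNIV. \<Sum>j\<in>UNIV. x $ i * P $ i $ j)"
    unfolding vector_matrix_mult_def vec_lambda_beta by (rule sum.swap)
  then show ?thesis
    using assms by (simp add: sum_distrib_left[symmetric] stochastic_row_sum)
qed

lemma stochastic_mult:
  assumes "stochastic A" "stochastic B"
  shows "stochastic (A ** B)"
proof (rule stochasticI)
  show "0 \<le> (A ** B) $ i $ j" for i j
    using assms by (simp add: matrix_matrix_mult_def sum_nonneg stochastic_nonneg)
  show "(\<Sum>j\<in>UNIV. (A ** B) $ i $ j) = 1" for i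
    using sum_vector_matrix_stochastic[OF assms(2), of "A $ i"] stochastic_row_sum[OF assms(1), of i]
    by (simp add: matrix_matrix_mult_def vector_matrix_mult_def)
qed

lemma stochastic_mat_1: "stochastic (mat 1)"
  by (rule stochasticI) (simp_all add: mat_def)

lemma stochastic_mpow: "stochastic P \<Longrightarrow> stochastic (mpow P k)"
  by (induction k) (simp_all add: stochastic_mat_1 stochastic_mult)

lemma mpow_add: "mpow P (a + b) = mpow P a ** mpow P b"
  by (induction a) (simp_all add: matrix_mul_assoc)

text \<open>This keeps the perturbation sizes bounded, so that the real supremum defining \<epsilon>
  really is an upper bound for each of them.\<close>

lemma mat_norm1_diff_le:
  assumes "stochastic P" "stochastic Q"
  shows "mat_norm1 (P - Q) \<le> 2"
proof -
  have "(\<Sum>j\<in>UNIV. \<bar>(P - Q) $ i $ j\<bar>) \<le> 2" for i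
  proof -
    have "(\<Sum>j\<in>UNIV. \<bar>(P - Q) $ i $ j\<bar>) \<le> (\<Sum>j\<in>UNIV. P $ i $ j + Q $ i $ j)"
    proof (rule sum_mono)
      fix j
      show "\<bar>(P - Q) $ i $ j\<bar> \<le> P $ i $ j + Q $ i $ j"
        using stochastic_nonneg[OF assms(1), of i j] stochastic_nonneg[OF assms(2), of i j] by simp
    qed
    then show ?thesis by (simp add: sum.distrib stochastic_row_sum assms)
  qed
  then show ?thesis by (simp add: mat_norm1_eq_Max)
qed

section \<open>The coefficient of ergodicity\<close>

lemma bdd_above_tau1:
  fixes P :: "real ^ 'n ^ 'n"
  shows "bdd_above (insert 0 {norm1 (transpose P *v z) | z. (\<Sum>i\<in>UNIV. z $ i) = 0 \<and> norm1 z = 1})"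
proof (rule bdd_aboveI)
  fix a assume "a \<in> insert 0 {norm1 (transpose P *v z) | z. (\<Sum>i\<in>UNIV. z $ i) = 0 \<and> norm1 z = 1}"
  then show "a \<le> max 0 (mat_norm1 P)"
  proof
    assume "a \<in> {norm1 (transpose P *v z) | z. (\<Sum>i\<in>UNIV. z $ i) = 0 \<and> norm1 z = 1}"
    then obtain z where "a = norm1 (z v* P)" "norm1 z = 1" by auto
    then show ?thesis using norm1_vector_matrix_le_mat_norm1[of z P] by simp
  qed simp
qed

lemma tau1_nonneg: "0 \<le> tau1 P"
  unfolding tau1_def by (rule cSup_upper[OF _ bdd_above_tau1]) simp

lemma tau1_le:
  fixes P :: "real ^ 'n ^ 'n"
  assumes "0 \<le> c"
    and "\<And>z. (\<Sum>i\<in>UNIV. z $ i) = 0 \<Longrightarrow> norm1 z = 1 \<Longrightarrow> norm1 (z v* P) \<le> c"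
  shows "tau1 P \<le> c"
  unfolding tau1_def using assms by (intro cSup_least) auto

text \<open>Homogeneity carries the bound from the unit sphere to all vectors of total mass 0; this
  is the form in which the coefficient is applied.\<close>

lemma norm1_vector_matrix_le_tau1:
  fixes P :: "real ^ 'n ^ 'n"
  assumes "(\<Sum>i\<in>UNIV. z $ i) = 0"
  shows "norm1 (z v* P) \<le> tau1 P * norm1 z"
proof (cases "z = 0")
  case True
  then show ?thesis by (simp add: norm1_def)
next
  case False
  then have pos: "0 < norm1 z" using norm1_nonneg[of z] norm1_eq_0_iff[of z] by linarith
  let ?w = "(1 / norm1 z) *\<^sub>R z"
  have "(\<Sum>i\<in>UNIV. ?w $ i) = (1 / norm1 z) * (\<Sum>i\<in>UNIV. z $ i)"
    by (simp add: sum_divide_distrib)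
  then have w0: "(\<Sum>i\<in>UNIV. ?w $ i) = 0" using assms by simp
  have w1: "norm1 ?w = 1" using pos by (simp only: norm1_scaleR) simp
  have "norm1 (transpose P *v ?w) \<le> tau1 P"
    unfolding tau1_def by (rule cSup_upper[OF _ bdd_above_tau1]) (use w0 w1 in blast)
  moreover have "norm1 (transpose P *v ?w) = norm1 (z v* P) / norm1 z"
    using pos unfolding transpose_matrix_vector scaleR_vector_matrix_assoc
    by (simp only: norm1_scaleR) simp
  ultimately show ?thesis using pos by (simp add: pos_divide_le_eq)
qed

text \<open>A stochastic \<open>A\<close> preserves total mass, so \<open>z v* A\<close> still sums
  to 0 and the contraction by \<open>B\<close> applies to it.\<close>

lemma tau1_mult_le:
  fixes A B :: "real ^ 'n ^ 'n"
  assumes "stochastic A"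
  shows "tau1 (A ** B) \<le> tau1 A * tau1 B"
proof (rule tau1_le)
  show "0 \<le> tau1 A * tau1 B" by (simp add: tau1_nonneg)
  fix z :: "real ^ 'n" assume z: "(\<Sum>i\<in>UNIV. z $ i) = 0" "norm1 z = 1"
  have "norm1 (z v* (A ** B)) \<le> tau1 B * norm1 (z v* A)"
    unfolding vector_matrix_mul_assoc[symmetric]
    by (rule norm1_vector_matrix_le_tau1) (simp add: sum_vector_matrix_stochastic assms z)
  also have "\<dots> \<le> tau1 B * tau1 A"
    using norm1_vector_matrix_le_tau1[of z A] z by (intro mult_left_mono tau1_nonneg) simp
  finally show "norm1 (z v* (A ** B)) \<le> tau1 A * tau1 B" by (simp add: mult.commute)
qed

text \<open>Mass-zero vectors of norm at most 1 are convex combinations of the vectors (e_i -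
  e_k)/2, so half of the largest row distance controls the contraction. This is the upper bound in
  Dobrushin's formula.\<close>

lemma tau1_le_of_row_distance:
  assumes d: "\<And>i k. (\<Sum>j\<in>UNIV. \<bar>P $ i $ j - P $ k $ j\<bar>) \<le> 2 * d"
  shows "tau1 P \<le> d"
proof (rule tau1_le)
  \<comment> \<open>Comparing any row with itself gives 0 on the left of \<open>d\<close>.\<close>
  show "0 \<le> d" using d[of undefined undefined] by simp
  fix z :: "real ^ 'a" assume z: "(\<Sum>i\<in>UNIV. z $ i) = 0" "norm1 z = 1"
  define p n where "p i = max (z $ i) 0" and "n i = max (- z $ i) 0" for i
  have zp: "z $ i = p i - n i" and ap: "\<bar>z $ i\<bar> = p i + n i" for i
    by (auto simp: p_def n_def)
  have nonneg: "0 \<le> p i" "0 \<le> n i" for i by (auto simp: p_def n_def)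
  have "sum p UNIV - sum n UNIV = 0" using z(1) by (simp add: zp sum_subtractf)
  moreover have "sum p UNIV + sum n UNIV = 1"
    using z(2) by (simp add: norm1_def ap sum.distrib)
  ultimately have half: "sum p UNIV = 1/2" "sum n UNIV = 1/2" by simp_all
  \<comment> \<open>Coupling: the positive and negative parts both have mass \<open>1/2\<close>, so pairing their
    product measure rewrites \<open>z P\<close> as a mixture of row differences.\<close>
  have "(z v* P) $ j = 2 * (\<Sum>i\<in>UNIV. \<Sum>k\<in>UNIV. p i * n k * (P $ i $ j - P $ k $ j))" for j
  proof -
    have "(\<Sum>i\<in>UNIV. \<Sum>k\<in>UNIV. p i * n k * (P $ i $ j - P $ k $ j))
      = (\<Sum>i\<in>UNIV. \<Sum>k\<in>UNIV. p i * P $ i $ j * n k) - (\<Sum>i\<in>UNIV. \<Sum>k\<in>UNIV. p i * (n k * P $ k $ j))"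
      by (simp add: algebra_simps sum_subtractf)
    also have "\<dots> = (\<Sum>i\<in>UNIV. p i * P $ i $ j) * sum n UNIV - sum p UNIV * (\<Sum>k\<in>UNIV. n k * P $ k $ j)"
      by (simp only: sum_product)
    finally show ?thesis
      by (simp add: half vector_matrix_mult_def zp left_diff_distrib sum_subtractf)
  qed
  then have "norm1 (z v* P) = (\<Sum>j\<in>UNIV. \<bar>2 * (\<Sum>i\<in>UNIV. \<Sum>k\<in>UNIV. p i * n k * (P $ i $ j - P $ k $ j))\<bar>)"
    by (simp add: norm1_def)
  also have "\<dots> \<le> (\<Sum>j\<in>UNIV. 2 * (\<Sum>i\<in>UNIV. \<Sum>k\<in>UNIV. p i * n k * \<bar>P $ i $ j - P $ k $ j\<bar>))"
  proof (rule sum_mono)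
    fix j
    have "\<bar>\<Sum>i\<in>UNIV. \<Sum>k\<in>UNIV. p i * n k * (P $ i $ j - P $ k $ j)\<bar>
      \<le> (\<Sum>i\<in>UNIV. \<Sum>k\<in>UNIV. \<bar>p i * n k * (P $ i $ j - P $ k $ j)\<bar>)"
      by (intro order_trans[OF sum_abs] sum_mono order_refl)
    then show "\<bar>2 * (\<Sum>i\<in>UNIV. \<Sum>k\<in>UNIV. p i * n k * (P $ i $ j - P $ k $ j))\<bar>
      \<le> 2 * (\<Sum>i\<in>UNIV. \<Sum>k\<in>UNIV. p i * n k * \<bar>P $ i $ j - P $ k $ j\<bar>)"
      by (simp add: abs_mult nonneg)
  qed
  also have "\<dots> = 2 * (\<Sum>j\<in>UNIV. \<Sum>i\<in>UNIV. \<Sum>k\<in>UNIV. p i * n k * \<bar>P $ i $ j - P $ k $ j\<bar>)"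
    by (simp add: sum_distrib_left)
  also have "(\<Sum>j\<in>UNIV. \<Sum>i\<in>UNIV. \<Sum>k\<in>UNIV. p i * n k * \<bar>P $ i $ j - P $ k $ j\<bar>)
    = (\<Sum>i\<in>UNIV. \<Sum>j\<in>UNIV. \<Sum>k\<in>UNIV. p i * n k * \<bar>P $ i $ j - P $ k $ j\<bar>)"
    by (rule sum.swap)
  also have "\<dots> = (\<Sum>i\<in>UNIV. \<Sum>k\<in>UNIV. p i * n k * (\<Sum>j\<in>UNIV. \<bar>P $ i $ j - P $ k $ j\<bar>))"
    unfolding sum_distrib_left by (intro sum.cong[OF refl] sum.swap)
  also have "\<dots> \<le> (\<Sum>i\<in>UNIV. \<Sum>k\<in>UNIV. p i * n k * (2 * d))"
    by (intro sum_mono mult_left_mono d) (simp add: nonneg)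
  \<comment> \<open>The weights have total mass 1/4, which cancels the outer factor 2 and the 2 in
    \<open>2 * d\<close>.\<close>
  also have "\<dots> = sum p UNIV * sum n UNIV * (2 * d)"
    by (simp only: sum_distrib_left[symmetric] sum_distrib_right[symmetric])
  finally show "norm1 (z v* P) \<le> d" by (simp add: half)
qed

lemma row_distance_eq:
  assumes "stochastic P"
  shows "(\<Sum>j\<in>UNIV. \<bar>P $ i $ j - P $ k $ j\<bar>) = 2 - 2 * (\<Sum>j\<in>UNIV. min (P $ i $ j) (P $ k $ j))"
proof -
  have "(\<Sum>j\<in>UNIV. \<bar>P $ i $ j - P $ k $ j\<bar>)
      = (\<Sum>j\<in>UNIV. P $ i $ j + P $ k $ j - 2 * min (P $ i $ j) (P $ k $ j))"
    by (rule sum.cong) (auto simp: min_def)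
  then show ?thesis
    by (simp add: sum_subtractf sum.distrib sum_distrib_left stochastic_row_sum assms)
qed

lemma tau1_le_1:
  assumes "stochastic P"
  shows "tau1 P \<le> 1"
proof (rule tau1_le_of_row_distance)
  have "0 \<le> (\<Sum>j\<in>UNIV. min (P $ i $ j) (P $ k $ j))" for i k
    by (simp add: sum_nonneg stochastic_nonneg assms)
  then show "(\<Sum>j\<in>UNIV. \<bar>P $ i $ j - P $ k $ j\<bar>) \<le> 2 * 1" for i k
    by (simp add: row_distance_eq assms)
qed

text \<open>Nonnegative rows that are not orthogonal share a column where both are positive, so any
  two rows overlap. There are finitely many pairs, so the least overlap is positive, and the
  coefficient is at most 1 minus it.\<close>

lemma tau1_less_1:
  assumes P: "stochastic P" and "scrambling P"
  shows "tau1 P < 1"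
proof -
  define c where "c = (\<lambda>(i, k). \<Sum>j\<in>UNIV. min (P $ i $ j) (P $ k $ j))"
  have c_pos: "0 < c (i, k)" for i k
  proof -
    have "\<exists>j. 0 < P $ i $ j \<and> 0 < P $ k $ j"
    proof (rule ccontr)
      assume none: "\<not> ?thesis"
      then have zero: "P $ i $ j * P $ k $ j = 0" for j
        using stochastic_nonneg[OF P, of i j] stochastic_nonneg[OF P, of k j]
        by (metis less_eq_real_def mult_eq_0_iff)
      then have "orthogonal (row i P) (row k P)"
        unfolding orthogonal_def inner_vec_def row_def by (simp only: inner_real_def vec_lambda_eta zero sum.neutral_const)
      \<comment> \<open>\<open>scrambling\<close> speaks of distinct rows only. For equal rows the
        vanishing products are squares, so the row would be 0, against its sum 1.\<close>
      with assms(2) have "i = k" by (auto simp: scrambling_def)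
      with zero have "P $ i $ j = 0" for j by (metis mult_eq_0_iff)
      then show False using stochastic_row_sum[OF P, of i] by simp
    qed
    then obtain j where "0 < P $ i $ j" "0 < P $ k $ j" by blast
    then show ?thesis
      unfolding c_def prod.case
      by (intro sum_pos2[of _ j]) (auto simp: stochastic_nonneg P)
  qed
  have "tau1 P \<le> 1 - Min (range c)"
  proof (rule tau1_le_of_row_distance)
    fix i k
    have "Min (range c) \<le> c (i, k)" by simp
    then show "(\<Sum>j\<in>UNIV. \<bar>P $ i $ j - P $ k $ j\<bar>) \<le> 2 * (1 - Min (range c))"
      by (simp add: row_distance_eq P c_def)
  qed
  moreover have "0 < Min (range c)" using c_pos by auto
  ultimately show ?thesis by linarith
qed

text \<open>Submultiplicativity peels off \<open>l div m\<close> blocks of length \<open>m\<close>;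
  the remaining \<open>l mod m\<close> steps cost a factor of at most 1.\<close>

lemma tau1_mpow_le:
  assumes "stochastic P"
  shows "tau1 (mpow P l) \<le> tau1 (mpow P m) ^ (l div m)"
proof -
  have "tau1 (mpow P (q * m + r)) \<le> tau1 (mpow P m) ^ q" for q r
  proof (induction q)
    case 0
    show ?case by (simp add: tau1_le_1 stochastic_mpow assms)
  next
    case (Suc q)
    have "tau1 (mpow P (Suc q * m + r)) \<le> tau1 (mpow P m) * tau1 (mpow P (q * m + r))"
      using tau1_mult_le[OF stochastic_mpow[OF assms], of m "mpow P (q * m + r)"]
      by (simp add: mpow_add[symmetric] add.assoc)
    also have "\<dots> \<le> tau1 (mpow P m) * tau1 (mpow P m) ^ q"
      by (intro mult_left_mono Suc tau1_nonneg)
    finally show ?case by simp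
  qed
  from this[of "l div m" "l mod m"] show ?thesis by simp
qed

lemma tau1_mpow_sum_le:
  assumes P: "stochastic P" and "1 \<le> m" and less: "tau1 (mpow P m) < 1"
  shows "(\<Sum>l<n. tau1 (mpow P l)) \<le> real m / (1 - tau1 (mpow P m))"
proof -
  let ?\<rho> = "tau1 (mpow P m)"
  \<comment> \<open>Padding with nonnegative terms makes the range split into \<open>n\<close> full
    blocks of length \<open>m\<close>, on each of which \<open>l div m\<close> is constant.\<close>
  have "(\<Sum>l<n. tau1 (mpow P l)) \<le> (\<Sum>l<n * m. tau1 (mpow P l))"
    using assms(2) by (intro sum_mono2) (auto simp: tau1_nonneg)
  also have "\<dots> \<le> (\<Sum>l<n * m. ?\<rho> ^ (l div m))"
    by (intro sum_mono tau1_mpow_le P)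
  also have "\<dots> = (\<Sum>q<n. \<Sum>l\<in>{q * m..<q * m + m}. ?\<rho> ^ (l div m))"
    by (rule sum.nat_group[symmetric])
  also have "\<dots> = (\<Sum>q<n. \<Sum>l\<in>{q * m..<q * m + m}. ?\<rho> ^ q)"
  proof (intro sum.cong refl)
    fix q l assume "l \<in> {q * m..<q * m + m}"
    then have "l div m = q" by (intro div_nat_eqI) (auto simp: algebra_simps)
    then show "?\<rho> ^ (l div m) = ?\<rho> ^ q" by simp
  qed
  also have "\<dots> = real m * (\<Sum>q<n. ?\<rho> ^ q)"
    by (simp add: sum_distrib_left)
  also have "\<dots> \<le> real m * (1 / (1 - ?\<rho>))"
  proof (rule mult_left_mono)
    show "(\<Sum>q<n. ?\<rho> ^ q) \<le> 1 / (1 - ?\<rho>)"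
      using sum_le_suminf[of "\<lambda>q. ?\<rho> ^ q" "{..<n}"] less
      by (simp add: suminf_geometric summable_geometric tau1_nonneg)
  qed simp
  finally show ?thesis by simp
qed

section \<open>Powers of an aperiodic matrix with one ergodic class\<close>

text \<open>Meant for the times at which a recurrent state can return to itself: aperiodicity makes
  their gcd 1, so return is possible at all late times.\<close>

lemma add_closed_Gcd_1_cofinite:
  fixes S :: "nat set"
  assumes add: "\<And>a b. a \<in> S \<Longrightarrow> b \<in> S \<Longrightarrow> a + b \<in> S"
    and zero: "0 \<in> S" and gcd: "Gcd S = 1"
  shows "\<exists>K. \<forall>k\<ge>K. k \<in> S"
proof -
  have mult: "c * a \<in> S" if "a \<in> S" for a c
    using that by (induction c) (auto intro: add zero)
  \<comment> \<open>The least positive difference of two elements divides every element, hence is \<open>1\<close>;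
    two consecutive elements \<open>a\<close>, \<open>a + 1\<close> then represent every \<open>k \<ge> a\<^sup>2\<close>.\<close>
  define D where "D d \<longleftrightarrow> 0 < d \<and> (\<exists>a\<in>S. a + d \<in> S)" for d
  have "\<exists>x\<in>S. x \<noteq> 0"
  proof (rule ccontr)
    assume "\<not> ?thesis"
    then have "S \<subseteq> {0}" by blast
    then have "Gcd S = 0" by (simp only: Gcd_0_iff)
    with gcd show False by simp
  qed
  then obtain x where "D x" unfolding D_def using zero by (metis add_0 neq0_conv)
  define d where "d = (LEAST d. D d)"
  have "D d" unfolding d_def by (rule LeastI) fact
  then obtain a where a: "0 < d" "a \<in> S" "a + d \<in> S" by (auto simp: D_def)
  have "d dvd x" if x: "x \<in> S" for x
  proof (rule ccontr)
    assume "\<not> d dvd x"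
    let ?q = "x div d"
    \<comment> \<open>Both \<open>?q * (a + d)\<close> and \<open>x + ?q * a\<close> lie in
      \<open>S\<close>; their difference is the remainder, a positive difference smaller than
      \<open>d\<close>.\<close>
    have "?q * (a + d) + x mod d = x + ?q * a" by (simp add: algebra_simps)
    with mult[OF a(3), of ?q] add[OF x mult[OF a(2), of ?q]] \<open>\<not> d dvd x\<close>
    have "D (x mod d)" unfolding D_def by (metis mod_0_imp_dvd neq0_conv)
    then have "d \<le> x mod d" unfolding d_def by (rule Least_le)
    with mod_less_divisor[OF a(1), of x] show False by linarith
  qed
  then have "d dvd Gcd S" by (rule Gcd_greatest)
  with gcd have succ: "Suc a \<in> S" using a(3) by simp
  have "k \<in> S" if "a * a \<le> k" for k
  proof (cases "a = 0")
    case True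
    with mult[OF succ, of k] show ?thesis by simp
  next
    case False
    \<comment> \<open>The quotient is at least \<open>a\<close> and so exceeds the remainder: the
      natural-number subtraction below is not truncated.\<close>
    have "a \<le> k div a" using that False by (simp add: less_eq_div_iff_mult_less_eq)
    then have le: "k mod a \<le> k div a" using False by (meson le_trans less_imp_le mod_less_divisor neq0_conv)
    have "k = (k div a - k mod a) * a + k mod a * Suc a"
    proof -
      have "(k div a - k mod a) * a + k mod a * Suc a = (k div a - k mod a + k mod a) * a + k mod a"
        by (simp add: distrib_right)
      then show ?thesis using le by simp
    qed
    then show ?thesis using add[OF mult[OF a(2)] mult[OF succ]] by metis
  qed
  then show ?thesis by blast
qed

section \<open>Accessibility and recurrence\<close>

lemma mpow_add_pos:
  assumes "stochastic P" "0 < mpow P a $ i $ j" "0 < mpow P b $ j $ k"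
  shows "0 < mpow P (a + b) $ i $ k"
  unfolding mpow_add matrix_matrix_mult_def vec_lambda_beta
proof (rule sum_pos2[of _ j])
  show "0 < mpow P a $ i $ j * mpow P b $ j $ k"
    using assms by (intro mult_pos_pos)
  show "0 \<le> mpow P a $ i $ l * mpow P b $ l $ k" for l
    by (intro mult_nonneg_nonneg stochastic_nonneg stochastic_mpow assms)
qed simp_all

lemma accessible_refl: "accessible P i i"
  unfolding accessible_def by (rule exI[of _ 0]) (simp add: mat_def)

lemma accessible_trans:
  assumes "stochastic P" "accessible P i j" "accessible P j k"
  shows "accessible P i k"
proof -
  obtain a b where "0 < mpow P a $ i $ j" "0 < mpow P b $ j $ k"
    using assms(2,3) by (auto simp: accessible_def)
  then have "0 < mpow P (a + b) $ i $ k" by (rule mpow_add_pos[OF assms(1)])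
  then show ?thesis by (auto simp: accessible_def)
qed

text \<open>Among the states reachable from \<open>i\<close>, take one with the fewest reachable
  states. Whatever it reaches has a reach set contained in its own and no smaller, hence equal, so
  this set is closed and communicating.\<close>

lemma accessible_ergodic_class:
  assumes P: "stochastic P"
  shows "\<exists>C. ergodic_class P C \<and> (\<forall>j\<in>C. accessible P i j)"
proof -
  define R where "R j = {k. accessible P j k}" for j
  obtain j where j: "j \<in> R i" and min: "\<And>k. k \<in> R i \<Longrightarrow> card (R j) \<le> card (R k)"
    using ex_has_least_nat[of "\<lambda>j. j \<in> R i" i "\<lambda>j. card (R j)"] accessible_refl[of P i]
    by (auto simp: R_def)
  have sub: "R k \<subseteq> R j" if "k \<in> R j" for j k
    using that accessible_trans[OF P] by (auto simp: R_def)
  have eq: "R k = R j" if k: "k \<in> R j" for k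
    using sub[OF k] min[of k] sub[OF j] k by (metis card_seteq finite subsetD)
  have "ergodic_class P (R j)"
    unfolding ergodic_class_def
  proof (intro conjI ballI allI impI)
    show "R j \<noteq> {}" using accessible_refl[of P j] by (auto simp: R_def)
    show "accessible P k l" if "k \<in> R j" "l \<in> R j" for k l
      using eq[OF that(1)] that(2) by (auto simp: R_def)
    show "l \<in> R j" if "k \<in> R j" "accessible P k l" for k l
      using eq[OF that(1)] that(2) by (auto simp: R_def)
  qed
  then show ?thesis using sub[OF j] by (auto simp: R_def)
qed

lemma eventually_scrambling:
  assumes P: "stochastic P" and "aperiodic P" and "\<exists>!C. ergodic_class P C"
  shows "\<exists>m\<ge>1. \<forall>k\<ge>m. scrambling (mpow P k)"
proof -
  obtain C where C: "ergodic_class P C" and uniq: "\<And>C'. ergodic_class P C' \<Longrightarrow> C' = C"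
    using assms(3) by blast
  obtain c where c: "c \<in> C" using C unfolding ergodic_class_def by blast
  define S where "S = {k. 0 < mpow P k $ c $ c}"
  have "\<exists>K. \<forall>k\<ge>K. k \<in> S"
  proof (rule add_closed_Gcd_1_cofinite)
    show "a + b \<in> S" if "a \<in> S" "b \<in> S" for a b
      using mpow_add_pos[OF P, of a c c b c] that by (simp add: S_def)
    show zero: "0 \<in> S" by (simp add: S_def mat_def)
    \<comment> \<open>\<open>period\<close> counts positive return times only; adjoining 0 does not
      change the gcd.\<close>
    have "S = insert 0 {k. 0 < k \<and> mpow P k $ c $ c > 0}" using zero by (auto simp: S_def)
    then have "Gcd S = period P c" by (simp add: period_def)
    then show "Gcd S = 1" using assms(2) C c by (simp add: aperiodic_def)
  qed
  then obtain K where K: "\<And>k. K \<le> k \<Longrightarrow> 0 < mpow P k $ c $ c" by (auto simp: S_def)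
  \<comment> \<open>The ergodic class reachable from \<open>i\<close> is \<open>C\<close> by
    uniqueness, so \<open>c\<close> is reachable.\<close>
  have "\<exists>r. 0 < mpow P r $ i $ c" for i
    using accessible_ergodic_class[OF P, of i] uniq c by (auto simp: accessible_def)
  then obtain r where r: "\<And>i. 0 < mpow P (r i) $ i $ c" by metis
  \<comment> \<open>After the \<open>r i\<close> steps from \<open>i\<close> to \<open>c\<close>, at
    least \<open>K\<close> steps remain for a return to \<open>c\<close>; \<open>Suc\<close> ensures
    that \<open>m\<close> is positive.\<close>
  define m where "m = Suc (K + Max (range r))"
  have "scrambling (mpow P k)" if "m \<le> k" for k
  proof -
    have pos: "0 < mpow P k $ i $ c" for i
    proof -
      have "r i \<le> Max (range r)" by simp
      then have "K \<le> k - r i" "r i + (k - r i) = k"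
        using that unfolding m_def by linarith+
      with mpow_add_pos[OF P r K, of "k - r i" i] show ?thesis by simp
    qed
    have "0 < (\<Sum>l\<in>UNIV. mpow P k $ i $ l * mpow P k $ j $ l)" for i j
      by (rule sum_pos2[of _ c]) (auto simp: pos stochastic_nonneg stochastic_mpow P)
    then show ?thesis
      by (simp add: scrambling_def orthogonal_def inner_vec_def row_def less_imp_neq[symmetric])
  qed
  moreover have "1 \<le> m" by (simp add: m_def)
  ultimately show ?thesis by blast
qed

section \<open>Evolution of the marginals\<close>

text \<open>Extensional functions on \<open>{..t}\<close> form a finite set in which every sample
  point has exactly one history, so the event splits into disjoint pieces.\<close>

lemma (in prob_space) prob_sum_histories:
  fixes X :: "nat \<Rightarrow> 'a \<Rightarrow> 'n :: finite"
  assumes [measurable]: "\<And>t. X t \<in> measurable M (count_space UNIV)" "Measurable.pred M A"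
  shows "\<P>(\<omega> in M. A \<omega>)
    = (\<Sum>x\<in>PiE {..t} (\<lambda>_. UNIV). \<P>(\<omega> in M. A \<omega> \<and> (\<forall>s\<le>t. X s \<omega> = x s)))"
proof (rule prob_sum)
  have "\<exists>!x. x \<in> PiE {..t} (\<lambda>_. UNIV) \<and> A \<omega> \<and> (\<forall>s\<le>t. X s \<omega> = x s)" if "A \<omega>" for \<omega>
  proof (rule ex1I[of _ "restrict (\<lambda>s. X s \<omega>) {..t}"])
    fix x assume "x \<in> PiE {..t} (\<lambda>_. UNIV) \<and> A \<omega> \<and> (\<forall>s\<le>t. X s \<omega> = x s)"
    then show "x = restrict (\<lambda>s. X s \<omega>) {..t}"
      by (intro PiE_ext[of x "{..t}" "\<lambda>_. UNIV"]) auto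
  qed (use that in auto)
  then show "AE \<omega> in M. (\<forall>x\<in>PiE {..t} (\<lambda>_. UNIV). A \<omega> \<and> (\<forall>s\<le>t. X s \<omega> = x s) \<longrightarrow> A \<omega>) \<and>
      (A \<omega> \<longrightarrow> (\<exists>!x\<in>PiE {..t} (\<lambda>_. UNIV). A \<omega> \<and> (\<forall>s\<le>t. X s \<omega> = x s)))"
    by auto
qed (auto intro: finite_PiE)

text \<open>The Markov property conditions on whole histories, while the claim involves only the
  present state. Sum over the histories up to \<open>t\<close>, then group them by their last
  state.\<close>

lemma marginal_Suc:
  fixes X :: "nat \<Rightarrow> 'a \<Rightarrow> 'n :: finite"
  assumes "markov_chain M X Q"
  shows "marginal M (X (Suc t)) = marginal M (X t) v* Q t"
proof -
  interpret prob_space M using assms by (simp add: markov_chain_def)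
  have meas[measurable]: "X t \<in> measurable M (count_space UNIV)" for t
    using assms by (simp add: markov_chain_def)
  define h where "h x = \<P>(\<omega> in M. \<forall>s\<le>t. X s \<omega> = x s)" for x
  let ?I = "PiE {..t} (\<lambda>_. UNIV) :: (nat \<Rightarrow> 'n) set"
  have step: "\<P>(\<omega> in M. X (Suc t) \<omega> = j \<and> (\<forall>s\<le>t. X s \<omega> = x s)) = h x * Q t $ x t $ j" for x j
  proof (cases "0 < h x")
    case True
    then have "\<P>(\<omega> in M. X (Suc t) \<omega> = j \<bar> \<forall>s\<le>t. X s \<omega> = x s) = Q t $ x t $ j"
      using assms by (simp add: markov_chain_def h_def)
    with True show ?thesis by (simp add: cond_prob_def h_def field_simps)
  next
    \<comment> \<open>Conditioning says nothing about a null history, but there both sides are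
      0.\<close>
    case False
    then have "h x = 0" by (simp add: h_def zero_less_measure_iff)
    moreover have "\<P>(\<omega> in M. X (Suc t) \<omega> = j \<and> (\<forall>s\<le>t. X s \<omega> = x s)) \<le> h x"
      unfolding h_def by (rule finite_measure_mono) auto
    ultimately show ?thesis by (simp add: antisym)
  qed
  have now: "marginal M (X t) $ i = (\<Sum>x\<in>?I. if x t = i then h x else 0)" for i
  proof -
    have "\<P>(\<omega> in M. X t \<omega> = i \<and> (\<forall>s\<le>t. X s \<omega> = x s)) = (if x t = i then h x else 0)" for x
    proof (cases "x t = i")
      case True
      then have "(X t \<omega> = i \<and> (\<forall>s\<le>t. X s \<omega> = x s)) = (\<forall>s\<le>t. X s \<omega> = x s)" for \<omega> by auto
      with True show ?thesis by (simp add: h_def)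
    next
      case False
      then have "{\<omega> \<in> space M. X t \<omega> = i \<and> (\<forall>s\<le>t. X s \<omega> = x s)} = {}" by auto
      with False show ?thesis by (simp only: measure_empty if_False)
    qed
    then show ?thesis
      using prob_sum_histories[of X, OF meas, of "\<lambda>\<omega>. X t \<omega> = i" t] by (simp add: marginal_def)
  qed
  show ?thesis
  proof (rule vec_eq_iff[THEN iffD2], rule allI)
    fix j
    have "marginal M (X (Suc t)) $ j = (\<Sum>x\<in>?I. h x * Q t $ x t $ j)"
      using prob_sum_histories[of X, OF meas, of "\<lambda>\<omega>. X (Suc t) \<omega> = j" t]
      by (simp add: marginal_def step)
    also have "\<dots> = (\<Sum>x\<in>?I. \<Sum>i\<in>UNIV. (if x t = i then h x else 0) * Q t $ i $ j)"
      by (simp add: if_distrib[of "\<lambda>a. a * _"] cong: if_cong)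
    also have "\<dots> = (\<Sum>i\<in>UNIV. marginal M (X t) $ i * Q t $ i $ j)"
      by (subst sum.swap) (simp add: now sum_distrib_right)
    finally show "marginal M (X (Suc t)) $ j = (marginal M (X t) v* Q t) $ j"
      by (simp add: vector_matrix_mult_def mult.commute)
  qed
qed

lemma distribution_marginal:
  fixes Y :: "'a \<Rightarrow> 'n :: finite"
  assumes "prob_space M" and [measurable]: "Y \<in> measurable M (count_space UNIV)"
  shows "distribution (marginal M Y)"
proof -
  interpret prob_space M by fact
  have "\<P>(\<omega> in M. True) = (\<Sum>i\<in>UNIV. \<P>(\<omega> in M. Y \<omega> = i))"
    by (rule prob_sum) auto
  then show ?thesis by (simp add: distribution_def marginal_def prob_space)
qed

text \<open>The extra factor \<open>mpow S k\<close> makes the claim inductive: the induction step passes from \<open>k\<close>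
  to \<open>k + 1\<close>.\<close>

lemma perturbation_bound:
  assumes S: "stochastic S" and inv: "invariant S \<sigma>"
    and Q: "\<And>t. stochastic (Q t)" "\<And>t. mat_norm1 (Q t - S) \<le> \<epsilon>"
    and y: "\<And>t. distribution (y t)" "\<And>t. y (Suc t) = y t v* Q t"
  shows "norm1 ((y n - \<sigma>) v* mpow S k)
    \<le> tau1 (mpow S (n + k)) * norm1 (y 0 - \<sigma>) + \<epsilon> * (\<Sum>l=k..<k + n. tau1 (mpow S l))"
proof (induction n arbitrary: k)
  case 0
  have "(\<Sum>i\<in>UNIV. (y 0 - \<sigma>) $ i) = 0"
    using y(1)[of 0] inv by (simp add: distribution_def invariant_def sum_subtractf)
  then show ?case using norm1_vector_matrix_le_tau1[of "y 0 - \<sigma>" "mpow S k"] by simp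
next
  case (Suc n)
  let ?w = "y n v* (Q n - S)"
  have "y (Suc n) - \<sigma> = (y n - \<sigma>) v* S + ?w"
    using inv by (simp add: y(2) invariant_def vector_matrix_mult_diff_distrib vector_matrix_mult_diff_rdistrib)
  then have split: "(y (Suc n) - \<sigma>) v* mpow S k = (y n - \<sigma>) v* mpow S (Suc k) + ?w v* mpow S k"
    by (simp add: vector_matrix_left_distrib vector_matrix_mul_assoc)
  have "(\<Sum>i\<in>UNIV. ?w $ i) = 0"
    by (simp add: vector_matrix_mult_diff_rdistrib sum_subtractf sum_vector_matrix_stochastic Q(1) S)
  then have "norm1 (?w v* mpow S k) \<le> tau1 (mpow S k) * norm1 ?w"
    by (rule norm1_vector_matrix_le_tau1)
  also have "\<dots> \<le> tau1 (mpow S k) * \<epsilon>"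
    using norm1_vector_matrix_le_mat_norm1[of "y n" "Q n - S"] Q(2)[of n] norm1_distribution[OF y(1)[of n]]
    by (intro mult_left_mono tau1_nonneg) simp
  finally have "norm1 (?w v* mpow S k) \<le> \<epsilon> * tau1 (mpow S k)" by (simp add: mult.commute)
  \<comment> \<open>The newest perturbation contributes the term at \<open>k\<close>; the older ones
    come from the hypothesis at \<open>Suc k\<close>.\<close>
  moreover have "(\<Sum>l=k..<k + Suc n. tau1 (mpow S l))
      = tau1 (mpow S k) + (\<Sum>l=Suc k..<Suc k + n. tau1 (mpow S l))"
    by (simp add: sum.atLeast_Suc_lessThan)
  ultimately show ?case
    using Suc[of "Suc k"] norm1_triangle[of "(y n - \<sigma>) v* mpow S (Suc k)" "?w v* mpow S k"]
    unfolding split by (simp add: distrib_left)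
qed

theorem lemma3:
  fixes P :: "'d \<Rightarrow> real ^ 'n ^ 'n" and \<Delta> :: "'d set"
    and Pstar :: "real ^ 'n ^ 'n" and \<sigma> :: "real ^ 'n" and \<epsilon> :: real
    and M :: "'a measure" and X :: "nat \<Rightarrow> 'a \<Rightarrow> 'n" and \<delta> :: "nat \<Rightarrow> 'd"
    and y :: "nat \<Rightarrow> real ^ 'n"
  assumes "\<And>d. d \<in> \<Delta> \<Longrightarrow> stochastic (P d)"
    and "stochastic Pstar" and "aperiodic Pstar" and "\<exists>!C. ergodic_class Pstar C"
    and "invariant Pstar \<sigma>"
    and "\<epsilon> = (SUP d\<in>\<Delta>. mat_norm1 (P d - Pstar))"
    and "\<And>t. \<delta> t \<in> \<Delta>"
    and "markov_chain M X (\<lambda>t. P (\<delta> t))"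
    and "\<And>t. y t = marginal M (X t)"
  shows "(\<forall>n\<ge>1. norm1 (y n - \<sigma>)
            \<le> tau1 (mpow Pstar n) * norm1 (y 0 - \<sigma>) + \<epsilon> * (\<Sum>l<n. tau1 (mpow Pstar l)))
       \<and> (limsup (\<lambda>n. ereal (norm1 (y n - \<sigma>))) \<le> ereal (\<epsilon> * Upsilon Pstar)
          \<and> summable (\<lambda>l. tau1 (mpow Pstar l))
          \<and> (\<exists>m\<ge>1. \<forall>k\<ge>m. scrambling (mpow Pstar k))
          \<and> (\<forall>m\<ge>1. (\<forall>k\<ge>m. scrambling (mpow Pstar k)) \<longrightarrow>
               Upsilon Pstar \<le> real m / (1 - tau1 (mpow Pstar m))))"
proof -
  note S = assms(2) and markov = assms(8)
  have Q: "stochastic (P (\<delta> t))" for t using assms(1,7) by blast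
  have bdd: "bdd_above ((\<lambda>d. mat_norm1 (P d - Pstar)) ` \<Delta>)"
    using mat_norm1_diff_le[OF assms(1) S] by (auto intro!: bdd_aboveI[of _ 2])
  have eps: "mat_norm1 (P (\<delta> t) - Pstar) \<le> \<epsilon>" for t
    unfolding assms(6) by (rule cSUP_upper[OF assms(7) bdd])
  have dist: "distribution (y t)" for t
    using markov by (simp add: assms(9) markov_chain_def distribution_marginal)
  have step: "y (Suc t) = y t v* P (\<delta> t)" for t
    unfolding assms(9) by (rule marginal_Suc[OF markov])
  note perturb = perturbation_bound[OF S assms(5),
      where y = y and Q = "\<lambda>t. P (\<delta> t)", OF Q eps dist step]
  have bound: "norm1 (y n - \<sigma>)
      \<le> tau1 (mpow Pstar n) * norm1 (y 0 - \<sigma>) + \<epsilon> * (\<Sum>l<n. tau1 (mpow Pstar l))" for n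
    \<comment> \<open>At \<open>k = 0\<close> the extra factor is the identity matrix.\<close>
    using perturb[of n 0]
    by (simp add: atLeast0LessThan)
  obtain m where m: "1 \<le> m" "\<And>k. m \<le> k \<Longrightarrow> scrambling (mpow Pstar k)"
    using eventually_scrambling[OF S assms(3,4)] by blast
  have sum_le: "(\<Sum>l<n. tau1 (mpow Pstar l)) \<le> real m / (1 - tau1 (mpow Pstar m))"
    if "1 \<le> m" "\<forall>k\<ge>m. scrambling (mpow Pstar k)" for m n
    using that by (intro tau1_mpow_sum_le S tau1_less_1 stochastic_mpow) auto
  have summable: "summable (\<lambda>l. tau1 (mpow Pstar l))"
    by (rule summableI_nonneg_bounded[OF tau1_nonneg sum_le[of m]]) (use m in auto)
  have "limsup (\<lambda>n. ereal (norm1 (y n - \<sigma>))) \<le> ereal (\<epsilon> * Upsilon Pstar)"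
  proof -
    let ?b = "\<lambda>n. tau1 (mpow Pstar n) * norm1 (y 0 - \<sigma>) + \<epsilon> * (\<Sum>l<n. tau1 (mpow Pstar l))"
    \<comment> \<open>The coefficients tend to 0 as terms of a convergent series, so the influence
      of the initial distribution vanishes.\<close>
    have "?b \<longlonglongrightarrow> 0 * norm1 (y 0 - \<sigma>) + \<epsilon> * Upsilon Pstar"
      unfolding Upsilon_def
      by (intro tendsto_intros summable_LIMSEQ_zero summable_LIMSEQ summable)
    then have "limsup (\<lambda>n. ereal (?b n)) = ereal (\<epsilon> * Upsilon Pstar)"
      by (intro lim_imp_Limsup) auto
    moreover have "limsup (\<lambda>n. ereal (norm1 (y n - \<sigma>))) \<le> limsup (\<lambda>n. ereal (?b n))"
      using bound by (intro Limsup_mono) auto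
    ultimately show ?thesis by simp
  qed
  moreover have "Upsilon Pstar \<le> real m / (1 - tau1 (mpow Pstar m))"
    if "1 \<le> m" "\<forall>k\<ge>m. scrambling (mpow Pstar k)" for m
    unfolding Upsilon_def by (rule suminf_le_const[OF summable sum_le[OF that]])
  ultimately show ?thesis using bound summable m by blast
qed

end
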